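(* There exists a constant $c_1 > 0$ such that, for all positive integers $n$, there exist integers $1 \leq a_1 < \ldots < a_k \leq n$ (for some $k$) such that there are at least $c_1 n^2$ distinct integers of the form $\sum_{i=u}^{v} a_i$ with $1 \leq u \leq v \leq k$. *)

theory Defs
  imports Complex_Main
begin

end

theory Submission
  imports Defs "HOL-Analysis.Convex"
begin

text \<open>
  The partial sums \<open>P i = i\<^sup>2\<close> almost work, but their differences form a multiplication table and so
  collide too often. We take \<open>P i = i\<^sup>2 + \<lfloor>j i / N\<rfloor>\<close> with \<open>N\<close> of order \<open>n\<close> and average over
  \<open>0 \<le> j < N\<close>. With \<open>l = v - u\<close> and \<open>x = u + v\<close>, a collision \<open>P v - P u = P v' - P u'\<close>
  forces \<open>\<bar>N l (x - x') + (l - l') (N x' + j)\<bar> < 2 N\<close>. For fixed \<open>l \<noteq> l'\<close> of order \<open>N\<close> this leaves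
  \<open>O(\<bar>l - l'\<bar>)\<close> values of \<open>x - x'\<close> and, for each of them, \<open>O(N / \<bar>l - l'\<bar>)\<close> values of \<open>N x' + j\<close>,
  which encodes both \<open>x'\<close> and \<open>j\<close>. Hence some \<open>j\<close> has only \<open>O(N\<^sup>2)\<close> collisions among \<open>N\<^sup>2\<close> pairs
  \<open>(u, v)\<close>, and the Cauchy-Schwarz inequality gives a positive proportion of \<open>N\<^sup>2\<close> distinct differences.
\<close>

section \<open>Counting tools: images versus collisions, and integers in an affine strip\<close>

lemma card_square_le_card_image_times_energy:
  fixes f :: "'a \<Rightarrow> 'b"
  assumes "finite A"
  shows "(card A)\<^sup>2 \<le> card (f ` A) * card {(p, q). p \<in> A \<and> q \<in> A \<and> f p = f q}"
proof -
  \<comment> \<open>\<open>card A\<close> and the number of colliding pairs are the first and second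
    moments of the fibre sizes \<open>r\<close>, so Cauchy-Schwarz against the constant 1 on the
    image compares them.\<close>
  define r where "r y = card {p \<in> A. f p = y}" for y
  have card_A: "card A = (\<Sum>y\<in>f ` A. r y)"
  proof -
    have "card A = (\<Sum>x\<in>A. 1)" by simp
    also have "\<dots> = (\<Sum>y\<in>f ` A. \<Sum>x\<in>{x \<in> A. f x = y}. 1)"
      using assms by (rule sum.image_gen)
    finally show ?thesis by (simp add: r_def)
  qed
  have "{(p, q). p \<in> A \<and> q \<in> A \<and> f p = f q}
      = (\<Union>y\<in>f ` A. {p \<in> A. f p = y} \<times> {p \<in> A. f p = y})"
    by auto
  also have "card \<dots> = (\<Sum>y\<in>f ` A. card ({p \<in> A. f p = y} \<times> {p \<in> A. f p = y}))"
    using assms by (intro card_UN_disjoint) auto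
  also have "\<dots> = (\<Sum>y\<in>f ` A. (r y)\<^sup>2)"
    by (simp add: r_def card_cartesian_product power2_eq_square)
  finally have energy: "card {(p, q). p \<in> A \<and> q \<in> A \<and> f p = f q} = (\<Sum>y\<in>f ` A. (r y)\<^sup>2)" .
  have "(\<Sum>y\<in>f ` A. real (r y))\<^sup>2 \<le> (\<Sum>y\<in>f ` A. (real (r y))\<^sup>2) * card (f ` A)"
    by (rule sum_squared_le_sum_of_squares)
  then have "real ((\<Sum>y\<in>f ` A. r y)\<^sup>2) \<le> real (card (f ` A) * (\<Sum>y\<in>f ` A. (r y)\<^sup>2))"
    by (simp add: mult.commute)
  then show ?thesis
    unfolding card_A energy of_nat_le_iff .
qed

text \<open>The solutions lie between their minimum and maximum, which differ by at most
  \<open>2 * b / \<bar>d\<bar>\<close>. Multiplying the count by \<open>\<bar>d\<bar>\<close> keeps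
  everything in the integers.\<close>

lemma card_int_affine_abs_less:
  fixes b c d :: int
  assumes "d \<noteq> 0" "0 \<le> b"
  shows "finite {y. \<bar>c + d * y\<bar> < b}"
    and "\<bar>d\<bar> * int (card {y. \<bar>c + d * y\<bar> < b}) \<le> 2 * b + \<bar>d\<bar>"
proof -
  define Y where "Y = {y. \<bar>c + d * y\<bar> < b}"
  have "Y \<subseteq> {- (b + \<bar>c\<bar>)..b + \<bar>c\<bar>}"
  proof
    fix y assume "y \<in> Y"
    then have "\<bar>d * y\<bar> \<le> b + \<bar>c\<bar>" by (simp add: Y_def)
    moreover have "1 * \<bar>y\<bar> \<le> \<bar>d\<bar> * \<bar>y\<bar>"
      using assms by (intro mult_right_mono) auto
    ultimately show "y \<in> {- (b + \<bar>c\<bar>)..b + \<bar>c\<bar>}" by (simp add: abs_mult) linarith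
  qed
  then have fin: "finite Y" by (rule finite_subset) simp
  then show "finite {y. \<bar>c + d * y\<bar> < b}" by (simp add: Y_def)
  have "\<bar>d\<bar> * int (card Y) \<le> 2 * b + \<bar>d\<bar>"
  proof (cases "Y = {}")
    case False
    have "Min Y \<in> Y" "Max Y \<in> Y" "Min Y \<le> Max Y" using fin False by auto
    moreover have "d * (Max Y - Min Y) = (c + d * Max Y) - (c + d * Min Y)"
      by (simp add: algebra_simps)
    moreover have "\<bar>c + d * y\<bar> < b" if "y \<in> Y" for y using that by (simp add: Y_def)
    ultimately have "\<bar>d * (Max Y - Min Y)\<bar> \<le> 2 * b" by smt
    then have "\<bar>d\<bar> * (Max Y - Min Y) \<le> 2 * b"
      using \<open>Min Y \<le> Max Y\<close> by (simp add: abs_mult)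
    moreover have "card Y \<le> card {Min Y..Max Y}"
      using fin by (intro card_mono) auto
    then have "int (card Y) \<le> Max Y - Min Y + 1"
      using \<open>Min Y \<le> Max Y\<close> by simp
    then have "\<bar>d\<bar> * int (card Y) \<le> \<bar>d\<bar> * (Max Y - Min Y + 1)"
      by (intro mult_left_mono) auto
    ultimately show ?thesis by (simp add: algebra_simps)
  qed (use assms in simp)
  then show "\<bar>d\<bar> * int (card {y. \<bar>c + d * y\<bar> < b}) \<le> 2 * b + \<bar>d\<bar>" by (simp add: Y_def)
qed

section \<open>Perturbed squares and the inequality forced by a collision\<close>

definition perturbed_square :: "int \<Rightarrow> int \<Rightarrow> int \<Rightarrow> int" where
  "perturbed_square N j i = i\<^sup>2 + (j * i) div N"

text \<open>The second coordinate is the length of the block rather than its right end, since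
  collisions are counted below with both lengths fixed.\<close>

definition block_sum :: "int \<Rightarrow> int \<Rightarrow> int \<times> int \<Rightarrow> int" where
  "block_sum N j = (\<lambda>(u, l). perturbed_square N j (u + l) - perturbed_square N j u)"

text \<open>Multiplied by \<open>N\<close>, each floor loses a remainder in \<open>{0..<N}\<close>;
  the error is a difference of two such remainders.\<close>

lemma block_sum_approx:
  assumes "0 < N"
  shows "\<bar>N * block_sum N j (u, l) - (N * (l * (2 * u + l)) + j * l)\<bar> < N"
proof -
  have "N * block_sum N j (u, l) - (N * (l * (2 * u + l)) + j * l)
      = N * ((j * (u + l)) div N) - N * ((j * u) div N) - j * l"
    by (simp add: block_sum_def perturbed_square_def algebra_simps power2_eq_square)
  also have "\<dots> = (j * u) mod N - (j * (u + l)) mod N"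
    by (simp add: minus_div_mult_eq_mod [symmetric] algebra_simps)
  finally show ?thesis
    using pos_mod_bound[OF assms, of "j * u"] pos_mod_bound[OF assms, of "j * (u + l)"]
      pos_mod_sign[OF assms, of "j * u"] pos_mod_sign[OF assms, of "j * (u + l)"]
    by linarith
qed

lemma block_sum_collision:
  assumes "0 < N" "block_sum N j (u, l) = block_sum N j (u', l')"
  shows "\<bar>N * l * ((2 * u + l) - (2 * u' + l')) + (l - l') * (N * (2 * u' + l') + j)\<bar> < 2 * N"
proof -
  have "N * l * ((2 * u + l) - (2 * u' + l')) + (l - l') * (N * (2 * u' + l') + j)
      = (N * (l * (2 * u + l)) + j * l) - (N * (l' * (2 * u' + l')) + j * l')"
    by (simp add: algebra_simps)
  then show ?thesis
    using block_sum_approx[OF assms(1), of j u l] block_sum_approx[OF assms(1), of j u' l']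
    unfolding assms(2) by linarith
qed

section \<open>Counting collisions between blocks of two fixed lengths\<close>

definition collisions :: "int \<Rightarrow> int \<Rightarrow> int \<Rightarrow> (int \<times> int \<times> int) set" where
  "collisions N l l' = {(j, u, u'). j \<in> {0..<N} \<and> u \<in> {0..<N} \<and> u' \<in> {0..<N} \<and>
     block_sum N j (u, l) = block_sum N j (u', l')}"

lemma finite_collisions: "finite (collisions N l l')"
  by (rule finite_subset[of _ "{0..<N} \<times> {0..<N} \<times> {0..<N}"]) (auto simp: collisions_def)

text \<open>For equal lengths the term with \<open>l - l'\<close> vanishes and the collision
  inequality forces \<open>u = u'\<close>, leaving only \<open>j\<close> and \<open>u\<close>
  free.\<close>

lemma card_collisions_same_length:
  assumes "2 \<le> N" "N \<le> l"
  shows "int (card (collisions N l l)) \<le> N\<^sup>2"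
proof -
  have "collisions N l l \<subseteq> (\<lambda>(j, u). (j, u, u)) ` ({0..<N} \<times> {0..<N})"
  proof
    fix w assume w: "w \<in> collisions N l l"
    obtain j u u' where [simp]: "w = (j, u, u')" by (cases w)
    have "\<bar>N * l * (2 * (u - u'))\<bar> < 2 * N"
      using block_sum_collision[of N j u l u' l] w assms
      by (simp add: collisions_def algebra_simps)
    then have "N * (l * \<bar>u - u'\<bar>) < N * 1"
      using assms by (simp add: abs_mult del: right_diff_distrib_numeral mult_less_cancel_left_pos)
    then have "l * \<bar>u - u'\<bar> < 1"
      using assms by (simp only: mult_less_cancel_left_pos)
    then have "u = u'"
      using assms mult_pos_pos[of l "\<bar>u - u'\<bar>"] by linarith
    then show "w \<in> (\<lambda>(j, u). (j, u, u)) ` ({0..<N} \<times> {0..<N})"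
      using w by (auto simp: collisions_def)
  qed
  then have "card (collisions N l l) \<le> card ({0..<N} \<times> {0..<N})"
    by (rule surj_card_le[rotated]) simp
  then show ?thesis
    using assms by (simp add: card_cartesian_product power2_eq_square le_nat_iff
        flip: nat_mult_distrib)
qed

text \<open>At most \<open>13 * \<bar>d\<bar>\<close> values of \<open>e\<close> occur, each with at
  most \<open>5 * N / \<bar>d\<bar>\<close> values of \<open>y\<close>; the factor
  \<open>\<bar>d\<bar>\<close> cancels.\<close>

lemma card_collisions_distinct_lengths:
  assumes "0 < N" "l \<in> {N..<2 * N}" "l' \<in> {N..<2 * N}" "l \<noteq> l'"
  shows "int (card (collisions N l l')) \<le> 65 * N"
proof -
  define d where "d = l - l'"
  have d: "1 \<le> \<bar>d\<bar>" "\<bar>d\<bar> \<le> N" "d \<noteq> 0" using assms by (auto simp: d_def)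
  define Y where "Y e = {y. \<bar>N * l * e + d * y\<bar> < 2 * N}" for e
  define E where "E = {- 6 * \<bar>d\<bar>..6 * \<bar>d\<bar>}"
  \<comment> \<open>The second coordinate has \<open>j\<close> as its last digit in base
    \<open>N\<close>, so it determines \<open>j\<close> and \<open>u'\<close>; the first then gives
    \<open>u\<close>.\<close>
  define \<phi> where "\<phi> = (\<lambda>(j, u, u'). ((2 * u + l) - (2 * u' + l'), N * (2 * u' + l') + j))"
  have "inj_on \<phi> (collisions N l l')"
  proof (rule inj_onI)
    fix w z assume wz: "w \<in> collisions N l l'" "z \<in> collisions N l l'" "\<phi> w = \<phi> z"
    obtain j u u' i t t' where [simp]: "w = (j, u, u')" "z = (i, t, t')"
      by (cases w, cases z)
    have ij: "0 \<le> j" "j < N" "0 \<le> i" "i < N" using wz by (auto simp: collisions_def)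
    have eq: "N * (2 * u' + l') + j = N * (2 * t' + l') + i"
      using wz by (simp add: \<phi>_def)
    then have "(N * (2 * u' + l') + j) mod N = (N * (2 * t' + l') + i) mod N" by simp
    then have "j = i" using ij by simp
    moreover from this have "u' = t'" using eq assms by simp
    moreover from this have "u = t" using wz by (simp add: \<phi>_def)
    ultimately show "w = z" by simp
  qed
  moreover have "\<phi> ` collisions N l l' \<subseteq> Sigma E Y"
  proof
    fix z assume "z \<in> \<phi> ` collisions N l l'"
    then obtain j u u' where w: "(j, u, u') \<in> collisions N l l'" and z: "z = \<phi> (j, u, u')"
      by auto
    define e y where "e = (2 * u + l) - (2 * u' + l')" and "y = N * (2 * u' + l') + j"
    have z: "z = (e, y)" by (simp add: z \<phi>_def e_def y_def)
    have less: "\<bar>N * l * e + d * y\<bar> < 2 * N"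
      unfolding e_def y_def d_def
      using w assms by (intro block_sum_collision) (auto simp: collisions_def)
    have x': "0 \<le> 2 * u' + l'" "2 * u' + l' + 1 \<le> 4 * N" and j: "0 \<le> j" "j < N"
      using w assms by (auto simp: collisions_def)
    \<comment> \<open>The bound \<open>y \<le> 4 * N\<^sup>2\<close> limits the term
      \<open>d * y\<close>, hence also \<open>N * l * e\<close>. Since \<open>l \<ge> N\<close>,
      this confines \<open>e\<close> to the window \<open>E\<close>.\<close>
    have "y \<le> N * (2 * u' + l' + 1)" using j by (simp add: y_def algebra_simps)
    also have "\<dots> \<le> N * (4 * N)" using assms x' by (intro mult_left_mono) auto
    finally have "y \<le> N * (4 * N)" .
    moreover have "0 \<le> y" using x' j assms by (simp add: y_def)
    ultimately have "\<bar>d\<bar> * \<bar>y\<bar> \<le> \<bar>d\<bar> * (N * (4 * N))" by (intro mult_left_mono) auto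
    then have "\<bar>N * l * e\<bar> < 2 * N + \<bar>d\<bar> * (N * (4 * N))"
      using less by (simp add: abs_mult [symmetric])
    then have "N * (l * \<bar>e\<bar>) < N * (2 + \<bar>d\<bar> * (4 * N))"
      using assms by (simp add: abs_mult algebra_simps)
    then have "l * \<bar>e\<bar> < 2 + \<bar>d\<bar> * (4 * N)"
      using assms by (simp only: mult_less_cancel_left_pos)
    moreover have "N * \<bar>e\<bar> \<le> l * \<bar>e\<bar>" using assms by (intro mult_right_mono) auto
    moreover have "1 * 1 \<le> \<bar>d\<bar> * N" using d assms by (intro mult_mono) auto
    ultimately have "N * \<bar>e\<bar> < N * (6 * \<bar>d\<bar>)" by (simp add: algebra_simps)
    then have "\<bar>e\<bar> < 6 * \<bar>d\<bar>" using assms by (simp only: mult_less_cancel_left_pos)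
    then show "z \<in> Sigma E Y" using less by (auto simp: z E_def Y_def)
  qed
  moreover have fin: "finite E" "finite (Y e)" for e
    using card_int_affine_abs_less(1)[OF d(3), of "2 * N" "N * l * e"] assms
    by (auto simp: E_def Y_def)
  ultimately have "card (collisions N l l') \<le> card (Sigma E Y)"
    by (intro card_inj_on_le) auto
  also have "\<dots> = (\<Sum>e\<in>E. card (Y e))" using fin by simp
  finally have "int (card (collisions N l l')) \<le> (\<Sum>e\<in>E. int (card (Y e)))"
    by (simp flip: of_nat_sum)
  then have "\<bar>d\<bar> * int (card (collisions N l l')) \<le> (\<Sum>e\<in>E. \<bar>d\<bar> * int (card (Y e)))"
    by (simp flip: sum_distrib_left add: mult_left_mono)
  also have "\<dots> \<le> (\<Sum>e\<in>E. 5 * N)"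
  proof (rule sum_mono)
    fix e
    show "\<bar>d\<bar> * int (card (Y e)) \<le> 5 * N"
      \<comment> \<open>The strip has \<open>b = 2 * N\<close>, so the bound is
        \<open>4 * N + \<bar>d\<bar>\<close>, and \<open>\<bar>d\<bar> \<le> N\<close>.\<close>
      using card_int_affine_abs_less(2)[OF d(3), of "2 * N" "N * l * e"] assms d
      by (simp add: Y_def)
  qed
  also have "\<dots> = (12 * \<bar>d\<bar> + 1) * (5 * N)" by (simp add: E_def)
  also have "\<dots> \<le> (13 * \<bar>d\<bar>) * (5 * N)" using d assms by (intro mult_right_mono) auto
  also have "\<dots> = \<bar>d\<bar> * (65 * N)" by simp
  finally show ?thesis using d by (simp only: mult_le_cancel_left_pos)
qed

section \<open>Averaging over the slope \<open>j\<close>\<close>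

lemma exists_many_block_sums:
  assumes "2 \<le> N"
  obtains j where "0 \<le> j" "j < N"
    "N\<^sup>2 \<le> 66 * int (card (block_sum N j ` ({0..<N} \<times> {N..<2 * N})))"
proof -
  define A where "A = {0..<N} \<times> {N..<2 * N}"
  define En where "En j = {(p, q). p \<in> A \<and> q \<in> A \<and> block_sum N j p = block_sum N j q}" for j
  define L where "L = {N..<2 * N}"
  have card_A: "int (card A) = N\<^sup>2"
    using assms by (simp add: A_def card_cartesian_product power2_eq_square)
  have finEn: "finite (En j)" for j
    by (rule finite_subset[of _ "A \<times> A"]) (auto simp: En_def A_def)
  \<comment> \<open>Reordering the coordinates turns the total over \<open>j\<close> into a total
    over pairs of lengths, where the two collision bounds apply.\<close>
  have "bij_betw (\<lambda>(j, (u, l), (u', l')). (l, l', j, u, u')) (Sigma {0..<N} En)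
      (SIGMA l:L. SIGMA l':L. collisions N l l')"
    by (rule bij_betw_byWitness[where f' = "\<lambda>(l, l', j, u, u'). (j, (u, l), (u', l'))"])
      (auto simp: En_def A_def L_def collisions_def)
  then have "card (Sigma {0..<N} En) = card (SIGMA l:L. SIGMA l':L. collisions N l l')"
    by (rule bij_betw_same_card)
  then have "(\<Sum>j\<in>{0..<N}. int (card (En j))) = (\<Sum>l\<in>L. \<Sum>l'\<in>L. int (card (collisions N l l')))"
    using finEn by (simp add: finite_collisions L_def flip: of_nat_sum)
  also have "\<dots> \<le> (\<Sum>l\<in>L. \<Sum>l'\<in>L. (if l' = l then N\<^sup>2 else 0) + 65 * N)"
  proof (intro sum_mono)
    fix l l' assume "l \<in> L" "l' \<in> L"
    then show "int (card (collisions N l l')) \<le> (if l' = l then N\<^sup>2 else 0) + 65 * N"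
      using card_collisions_same_length[of N l] card_collisions_distinct_lengths[of N l l'] assms
      by (auto simp: L_def)
  qed
  \<comment> \<open>The diagonal gives \<open>N * N\<^sup>2\<close> and the uniform term
    \<open>N\<^sup>2 * (65 * N)\<close>. The total is written as a sum over the \<open>N\<close>
    values of \<open>j\<close>, so that some \<open>j\<close> is at most average.\<close>
  also have "\<dots> = (\<Sum>j\<in>{0..<N}. 66 * N\<^sup>2)"
    using assms by (simp add: sum.distrib L_def power2_eq_square algebra_simps)
  finally have "\<exists>j\<in>{0..<N}. int (card (En j)) \<le> 66 * N\<^sup>2"
    using assms sum_strict_mono[of "{0..<N}" "\<lambda>_. 66 * N\<^sup>2" "\<lambda>j. int (card (En j))"]
    by (force simp: not_le)
  then obtain j where j: "j \<in> {0..<N}" "int (card (En j)) \<le> 66 * N\<^sup>2" by blast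
  have "(card A)\<^sup>2 \<le> card (block_sum N j ` A) * card (En j)"
    unfolding En_def by (rule card_square_le_card_image_times_energy) (simp add: A_def)
  then have "int ((card A)\<^sup>2) \<le> int (card (block_sum N j ` A) * card (En j))"
    by (simp only: of_nat_le_iff)
  then have "N\<^sup>2 * N\<^sup>2 \<le> int (card (block_sum N j ` A)) * int (card (En j))"
    using card_A by (simp add: power2_eq_square)
  also have "\<dots> \<le> int (card (block_sum N j ` A)) * (66 * N\<^sup>2)"
    using j by (intro mult_left_mono) auto
  finally have "N\<^sup>2 * N\<^sup>2 \<le> N\<^sup>2 * (66 * int (card (block_sum N j ` A)))"
    by (simp add: algebra_simps)
  moreover have "0 < N\<^sup>2" using assms by simp
  ultimately have "N\<^sup>2 \<le> 66 * int (card (block_sum N j ` A))"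
    by (simp only: mult_le_cancel_left_pos)
  with j that show ?thesis by (auto simp: A_def)
qed

section \<open>Turning block sums into sums of consecutive terms of a sequence\<close>

lemma perturbed_square_step:
  assumes "0 \<le> j" "j < N"
  shows "perturbed_square N j i - perturbed_square N j (i - 1) \<in> {2 * i - 1..2 * i}"
proof -
  \<comment> \<open>As the slope \<open>j / N\<close> lies in \<open>[0, 1)\<close>, the floor rises
    by 0 or 1 while the square rises by \<open>2 * i - 1\<close>.\<close>
  have "(j * (i - 1)) div N \<le> (j * i) div N"
    using assms by (intro zdiv_mono1 mult_left_mono) auto
  moreover have "(j * i) div N \<le> (j * (i - 1) + N) div N"
    using assms by (intro zdiv_mono1) (auto simp: algebra_simps)
  moreover have "(j * (i - 1) + N) div N = (j * (i - 1)) div N + 1"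
    using assms by simp
  ultimately show ?thesis
    by (simp add: perturbed_square_def power2_eq_square algebra_simps)
qed

lemma exists_sequence_many_consecutive_sums:
  fixes n :: nat
  assumes "12 \<le> n"
  shows "\<exists>(k :: nat) (a :: nat \<Rightarrow> int).
    strict_mono_on {1..k} a \<and> (\<forall>i \<in> {1..k}. 1 \<le> a i \<and> a i \<le> int n) \<and>
    n\<^sup>2 \<le> 10000 * card {\<Sum>i = u..v. a i | u v. 1 \<le> u \<and> u \<le> v \<and> v \<le> k}"
proof -
  \<comment> \<open>Blocks end before \<open>3 * N\<close> and \<open>a i \<le> 2 * i\<close>, so
    the terms stay at most \<open>6 * N \<le> n\<close>. The condition \<open>12 \<le> n\<close>
    ensures \<open>2 \<le> N\<close> and \<open>n \<le> 12 * N\<close>.\<close>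
  define N where "N = int (n div 6)"
  have N: "2 \<le> N" "6 * N \<le> int n" "int n \<le> 12 * N" using assms by (auto simp: N_def)
  obtain j where j: "0 \<le> j" "j < N"
    and many: "N\<^sup>2 \<le> 66 * int (card (block_sum N j ` ({0..<N} \<times> {N..<2 * N})))"
    using exists_many_block_sums[OF N(1)] .
  define a where "a i = perturbed_square N j (int i) - perturbed_square N j (int i - 1)" for i :: nat
  define k where "k = nat (3 * N)"
  define S where "S = {\<Sum>i = u..v. a i | u v. 1 \<le> u \<and> u \<le> v \<and> v \<le> k}"
  have a: "2 * int i - 1 \<le> a i" "a i \<le> 2 * int i" for i
    using perturbed_square_step[OF j, of "int i"] by (auto simp: a_def)
  \<comment> \<open>The intervals from \<open>2 * i - 1\<close> to \<open>2 * i\<close> are disjoint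
    and increase with \<open>i\<close>.\<close>
  have "strict_mono_on {1..k} a"
  proof (rule strict_mono_onI)
    fix r s :: nat assume "r < s"
    then show "a r < a s" using a(2)[of r] a(1)[of s] by linarith
  qed
  moreover have "1 \<le> a i \<and> a i \<le> int n" if "i \<in> {1..k}" for i
    using a[of i] that N by (auto simp: k_def)
  moreover have "n\<^sup>2 \<le> 10000 * card S"
  proof -
    have telescope: "(\<Sum>i = Suc u..u + m. a i) = block_sum N j (int u, int m)" for u m
      by (induction m) (auto simp: a_def block_sum_def algebra_simps)
    have "block_sum N j ` ({0..<N} \<times> {N..<2 * N}) \<subseteq> S"
    proof clarify
      fix u l assume ul: "u \<in> {0..<N}" "l \<in> {N..<2 * N}"
      then have "block_sum N j (u, l) = (\<Sum>i = Suc (nat u)..nat u + nat l. a i)"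
        by (simp add: telescope)
      then show "block_sum N j (u, l) \<in> S"
        unfolding S_def mem_Collect_eq using ul N
        by (intro exI[of _ "Suc (nat u)"] exI[of _ "nat u + nat l"]) (auto simp: k_def)
    qed
    moreover have "S \<subseteq> (\<lambda>(u, v). \<Sum>i = u..v. a i) ` ({..k} \<times> {..k})"
      by (auto simp: S_def)
    then have "finite S" by (rule finite_subset) simp
    ultimately have "card (block_sum N j ` ({0..<N} \<times> {N..<2 * N})) \<le> card S"
      by (intro card_mono)
    then have "N\<^sup>2 \<le> 66 * int (card S)" using many by linarith
    moreover have "(int n)\<^sup>2 \<le> (12 * N)\<^sup>2" using N by (intro power_mono) auto
    \<comment> \<open>The constant comes from \<open>144 * 66 = 9504\<close>.\<close>
    ultimately have "int (n\<^sup>2) \<le> int (10000 * card S)" by (simp add: power_mult_distrib)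
    then show ?thesis by (simp only: of_nat_le_iff)
  qed
  ultimately show ?thesis unfolding S_def by blast
qed

theorem theorem1p1:
  "\<exists>c\<^sub>1 :: real. c\<^sub>1 > 0 \<and>
     (\<forall>n :: nat. n \<ge> 1 \<longrightarrow>
       (\<exists>(k :: nat) (a :: nat \<Rightarrow> int).
          strict_mono_on {1..k} a \<and>
          (\<forall>i \<in> {1..k}. 1 \<le> a i \<and> a i \<le> int n) \<and>
          real (card {\<Sum>i = u..v. a i | u v. 1 \<le> u \<and> u \<le> v \<and> v \<le> k}) \<ge> c\<^sub>1 * (real n)\<^sup>2))"
proof (intro exI[of _ "1 / 10000"] conjI allI impI)
  fix n :: nat assume "1 \<le> n"
  let ?sums = "\<lambda>k (a :: nat \<Rightarrow> int). {\<Sum>i = u..v. a i | u v. 1 \<le> u \<and> u \<le> v \<and> v \<le> k}"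
  have "\<exists>(k :: nat) (a :: nat \<Rightarrow> int). strict_mono_on {1..k} a \<and>
    (\<forall>i \<in> {1..k}. 1 \<le> a i \<and> a i \<le> int n) \<and> n\<^sup>2 \<le> 10000 * card (?sums k a)"
  proof (cases "12 \<le> n")
    case True
    then show ?thesis by (rule exists_sequence_many_consecutive_sums)
  next
    case False
    \<comment> \<open>For \<open>n < 12\<close> a single sum is enough, because
      \<open>n\<^sup>2 \<le> 144\<close>.\<close>
    have "?sums 1 (\<lambda>_. 1) = {1}"
    proof -
      have "1 \<le> u \<and> u \<le> v \<and> v \<le> 1 \<longleftrightarrow> u = 1 \<and> v = 1" for u v :: nat by auto
      then show ?thesis by simp
    qed
    moreover have "n\<^sup>2 \<le> 12\<^sup>2" using False by (intro power_mono) auto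
    ultimately have "n\<^sup>2 \<le> 10000 * card (?sums 1 (\<lambda>_. 1))" by simp
    moreover have "strict_mono_on {1..1 :: nat} (\<lambda>_. 1 :: int)"
      by (rule strict_mono_onI) auto
    ultimately show ?thesis using \<open>1 \<le> n\<close>
      by (intro exI[of _ "1 :: nat"] exI[of _ "\<lambda>_. 1 :: int"]) auto
  qed
  then obtain k :: nat and a :: "nat \<Rightarrow> int" where
    "strict_mono_on {1..k} a" "\<forall>i \<in> {1..k}. 1 \<le> a i \<and> a i \<le> int n"
    and le: "n\<^sup>2 \<le> 10000 * card (?sums k a)" by blast
  moreover have "real (n\<^sup>2) \<le> real (10000 * card (?sums k a))"
    using le by (simp only: of_nat_le_iff)
  then have "1 / 10000 * (real n)\<^sup>2 \<le> real (card (?sums k a))" by simp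
  ultimately show "\<exists>(k :: nat) (a :: nat \<Rightarrow> int). strict_mono_on {1..k} a \<and>
    (\<forall>i \<in> {1..k}. 1 \<le> a i \<and> a i \<le> int n) \<and>
    1 / 10000 * (real n)\<^sup>2 \<le> real (card (?sums k a))" by blast
qed simp

end
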